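(* The solutions of the equation $$(x+y)^z = (2x)^z + y^z$$ in positive integers $x, y, z$ are exactly the triples $(x,y,z) = (2t, 3t, 2)$, where $t$ is a positive integer. *)

theory Defs
  imports Main
begin

end

theory Submission
  imports Defs "HOL-Number_Theory.Number_Theory"
begin

text \<open>
  After dividing by the gcd we may take \<open>x\<close> and \<open>y\<close> coprime. If an odd prime \<open>p\<close> divided \<open>x\<close>, then
  lifting the exponent in \<open>(x + y)^z - y^z = x (2^z x^(z - 1))\<close> would force \<open>p^(z - 1)\<close> to divide
  \<open>z\<close>, which is impossible for \<open>z \<ge> 2\<close>. So \<open>x\<close> is a power of \<open>2\<close>. Parity excludes \<open>x = 1\<close>, and for
  even \<open>x\<close> it excludes odd \<open>z\<close>. For \<open>z = 2m\<close> the numbers \<open>(x + y)^m \<plusminus> y^m\<close> are powers of \<open>2\<close>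
  that are not both divisible by \<open>4\<close>, so the smaller one is \<open>2\<close>, whence \<open>x = 2\<close> and \<open>m = 1\<close>.
\<close>

text \<open>The cofactor of \<open>a - b\<close> in \<open>a ^ n - b ^ n\<close> is congruent to
  \<open>n * b ^ (n - 1)\<close> modulo \<open>p\<close>, hence a unit there. Oddness of
  \<open>p\<close> is not assumed: the case \<open>p = 2\<close> settles odd \<open>z\<close>
  later.\<close>

lemma not_prime_mult_diff_dvd_power_diff:
  fixes a b :: int and p n :: nat
  assumes p: "prime p" and ab: "int p dvd a - b" and b: "\<not> int p dvd b"
    and n: "\<not> p dvd n" and "a \<noteq> b"
  shows "\<not> (a - b) * int p dvd a ^ n - b ^ n"
proof
  assume *: "(a - b) * int p dvd a ^ n - b ^ n"
  define Q where "Q = (\<Sum>i<n. b ^ (n - Suc i) * a ^ i)"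
  have "a ^ n - b ^ n = (a - b) * Q"
    unfolding Q_def by (rule power_diff_sumr2)
  with * \<open>a \<noteq> b\<close> have "int p dvd Q" by simp
  moreover have "[Q = (\<Sum>i<n. b ^ (n - 1))] (mod int p)"
    unfolding Q_def
  proof (rule cong_sum)
    fix i assume "i \<in> {..<n}"
    then have "b ^ (n - 1) = b ^ (n - Suc i) * b ^ i"
      by (simp flip: power_add)
    moreover have "[a = b] (mod int p)"
      using ab by (simp add: cong_iff_dvd_diff)
    ultimately show "[b ^ (n - Suc i) * a ^ i = b ^ (n - 1)] (mod int p)"
      by (metis cong_mult cong_pow cong_refl)
  qed
  ultimately have "int p dvd int n * b ^ (n - 1)"
    by (simp add: cong_dvd_iff)
  moreover have "prime (int p)" using p by simp
  ultimately show False
    using b n by (metis int_dvd_int_iff prime_dvd_mult_iff prime_dvd_power)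
qed

text \<open>Binomial expansion to first order in \<open>d\<close>. The exponent \<open>Suc i\<close>
  keeps truncated subtraction out of the linear term.\<close>

lemma power_add_mult_cong_square:
  fixes b c d :: int
  shows "[(b + d * c) ^ Suc i = b ^ Suc i + int (Suc i) * d * c * b ^ i] (mod d ^ 2)"
proof (induction i)
  case (Suc i)
  have "[(b + d * c) ^ Suc (Suc i) =
        (b + d * c) * (b ^ Suc i + int (Suc i) * d * c * b ^ i)] (mod d ^ 2)"
    using cong_mult[OF cong_refl Suc.IH] by simp
  also have "(b + d * c) * (b ^ Suc i + int (Suc i) * d * c * b ^ i) =
      (b ^ Suc (Suc i) + int (Suc (Suc i)) * d * c * b ^ Suc i)
      + d ^ 2 * (int (Suc i) * c ^ 2 * b ^ i)"
    by (simp add: algebra_simps power2_eq_square)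
  finally show ?case
    by (simp add: cong_def)
qed simp

text \<open>Raising to the power \<open>p\<close> gains exactly one factor \<open>p\<close>: with
  \<open>a = b + p * c\<close>, the cofactor is \<open>p * b ^ (p - 1)\<close> modulo
  \<open>p ^ 2\<close>, since the linear terms add up to a multiple of
  \<open>p * (p * (p - 1) div 2)\<close>.\<close>

lemma odd_prime_power_diff_eq:
  fixes a b :: int and p :: nat
  assumes p: "prime p" "odd p" and ab: "int p dvd a - b" and b: "\<not> int p dvd b"
  obtains u where "a ^ p - b ^ p = (a - b) * (int p * u)" "\<not> int p dvd u"
proof -
  define q where "q = int p"
  obtain c where "a - b = q * c" using ab unfolding q_def by (elim dvdE)
  then have a: "a = b + q * c" by simp
  define Q where "Q = (\<Sum>i<p. b ^ (p - Suc i) * a ^ i)"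
  have Q: "a ^ p - b ^ p = (a - b) * Q"
    unfolding Q_def by (rule power_diff_sumr2)
  have p2: "p \<ge> 2" using p prime_ge_2_nat by blast
  have "[Q = (\<Sum>i<p. b ^ (p - 1) + int i * (q * c * b ^ (p - 2)))] (mod q ^ 2)"
    unfolding Q_def
  proof (rule cong_sum)
    fix i assume i: "i \<in> {..<p}"
    show "[b ^ (p - Suc i) * a ^ i = b ^ (p - 1) + int i * (q * c * b ^ (p - 2))] (mod q ^ 2)"
    proof (cases i)
      case (Suc j)
      have "[b ^ (p - Suc i) * a ^ i =
          b ^ (p - Suc i) * (b ^ Suc j + int (Suc j) * q * c * b ^ j)] (mod q ^ 2)"
        unfolding Suc a by (rule cong_mult[OF cong_refl power_add_mult_cong_square])
      also have "b ^ (p - Suc i) * (b ^ Suc j + int (Suc j) * q * c * b ^ j)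
        = b ^ (p - Suc i + Suc j) + int i * (q * c * b ^ (p - Suc i + j))"
        unfolding power_add Suc by (simp add: algebra_simps)
      also have "p - Suc i + Suc j = p - 1" using i Suc by auto
      also have "p - Suc i + j = p - 2" using i Suc by auto
      finally show ?thesis .
    qed simp
  qed
  also have "(\<Sum>i<p. b ^ (p - 1) + int i * (q * c * b ^ (p - 2)))
      = q * b ^ (p - 1) + (\<Sum>i<p. int i) * (q * c * b ^ (p - 2))"
    by (simp add: sum.distrib sum_distrib_right q_def)
  also have "(\<Sum>i<p. int i) = q * int ((p - 1) div 2)"
  proof -
    have "(\<Sum>i<p. i) = p * (p - 1) div 2"
      using p2 Sum_Ico_nat[of 0 p] by (simp add: atLeast0LessThan)
    \<comment> \<open>Oddness of \<open>p\<close> enters here: \<open>p - 1\<close> is even, so the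
      sum keeps its factor \<open>p\<close>.\<close>
    also have "\<dots> = p * ((p - 1) div 2)"
      using p by (simp add: div_mult_swap)
    finally have "int (\<Sum>i<p. i) = int (p * ((p - 1) div 2))" by simp
    then show ?thesis
      by (simp only: of_nat_sum of_nat_mult q_def)
  qed
  also have "q * b ^ (p - 1) + q * int ((p - 1) div 2) * (q * c * b ^ (p - 2))
      = q * b ^ (p - 1) + q ^ 2 * (int ((p - 1) div 2) * c * b ^ (p - 2))"
    by (simp add: power2_eq_square)
  finally have "[Q = q * b ^ (p - 1)] (mod q ^ 2)"
    by (simp add: cong_def)
  then obtain k where "Q - q * b ^ (p - 1) = q ^ 2 * k"
    by (auto simp: cong_iff_dvd_diff)
  then have "Q = q * (b ^ (p - 1) + q * k)"
    by (simp add: algebra_simps power2_eq_square)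
  moreover have "\<not> q dvd b ^ (p - 1) + q * k"
  proof
    assume "q dvd b ^ (p - 1) + q * k"
    then have "q dvd b ^ (p - 1)" by (simp add: dvd_add_left_iff)
    moreover have "prime q" using p by (simp add: q_def)
    ultimately show False using b prime_dvd_power unfolding q_def by blast
  qed
  ultimately show ?thesis
    using that Q unfolding q_def by metis
qed

text \<open>Lifting the exponent, phrased without valuations. If \<open>s > 0\<close>, then
  \<open>p\<close> divides \<open>n\<close>; for \<open>n = p * m\<close>, passing from
  \<open>a ^ m - b ^ m\<close> to \<open>a ^ n - b ^ n\<close> adds exactly one factor
  \<open>p\<close>, so the hypothesis descends to \<open>m\<close> and \<open>s - 1\<close>.\<close>

lemma prime_power_dvd_exponent:
  fixes a b :: int and p n s :: nat
  assumes p: "prime p" "odd p" and ab: "int p dvd a - b" and b: "\<not> int p dvd b"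
    and pos: "0 < b" "b < a" and "(a - b) * int p ^ s dvd a ^ n - b ^ n"
  shows "p ^ s dvd n"
  using assms(7)
proof (induction n arbitrary: s rule: less_induct)
  case (less n)
  consider "n = 0" | "s = 0" | "n > 0" "s > 0" by auto
  then show ?case
  proof cases
    case 3
    then obtain r where s: "s = Suc r" by (cases s) auto
    have "(a - b) * int p dvd (a - b) * int p ^ s"
      using s by simp
    then have "(a - b) * int p dvd a ^ n - b ^ n"
      using less.prems dvd_trans by blast
    then have "p dvd n"
      using not_prime_mult_diff_dvd_power_diff[OF p(1) ab b] pos by fastforce
    then obtain m where n: "n = p * m" by blast
    have "m > 0" "m < n" using 3 n prime_gt_1_nat[OF p(1)] by auto
    have dvd: "a - b dvd a ^ m - b ^ m"
      using power_diff_sumr2[of a m b] by simp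
    have "int p dvd a ^ m - b ^ m" using ab dvd dvd_trans by blast
    moreover have "\<not> int p dvd b ^ m"
      using b p by (meson prime_dvd_power prime_nat_int_transfer)
    ultimately obtain u where u: "(a ^ m) ^ p - (b ^ m) ^ p = (a ^ m - b ^ m) * (int p * u)"
        "\<not> int p dvd u"
      using odd_prime_power_diff_eq[OF p] by metis
    obtain R where R: "a ^ m - b ^ m = (a - b) * R" using dvd by blast
    have "(a - b) * int p ^ s dvd (a - b) * (R * (int p * u))"
      using less.prems u R unfolding n by (simp add: power_mult mult.commute[of p m] mult.assoc)
    then have "int p * int p ^ r dvd int p * (R * u)"
      using pos unfolding s by (simp add: mult_ac)
    then have "int p ^ r dvd R * u"
      using p(1) by (simp add: prime_gt_0_nat)
    moreover have "coprime (int p ^ r) u"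
      using u p by (meson coprime_power_left_iff prime_imp_coprime prime_nat_int_transfer)
    ultimately have "int p ^ r dvd R"
      using coprime_dvd_mult_left_iff by blast
    then have "(a - b) * int p ^ r dvd a ^ m - b ^ m"
      unfolding R by simp
    from less.IH[OF \<open>m < n\<close> this] show ?thesis
      unfolding n s by simp
  qed auto
qed

text \<open>A prime factor of \<open>n div 2\<close> would divide \<open>w\<close>, hence be
  \<open>2\<close>, and then \<open>4\<close> would divide \<open>n\<close>.\<close>

lemma eq_two_if_not_four_dvd:
  fixes n w k :: nat
  assumes w: "\<And>p. prime p \<Longrightarrow> p dvd w \<Longrightarrow> p = 2"
    and "n dvd w ^ k" "even n" "\<not> 4 dvd n"
  shows "n = 2"
proof -
  obtain d where d: "n = 2 * d" using \<open>even n\<close> by blast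
  have "d = 1"
  proof (rule ccontr)
    assume "d \<noteq> 1"
    then obtain p where p: "prime p" "p dvd d" using prime_factor_nat by blast
    then have "p dvd w ^ k" using assms(2) d by (meson dvd_mult dvd_trans)
    then have "p = 2" using w p prime_dvd_power by blast
    then show False using p assms(4) d by auto
  qed
  then show ?thesis using d by simp
qed

lemma less_three_power_pred:
  "n \<ge> 2 \<Longrightarrow> n < 3 ^ (n - 1)" for n :: nat
proof (induction n rule: dec_induct)
  case (step n)
  have "(3::nat) ^ (Suc n - 1) = 3 * 3 ^ (n - 1)"
    using step by (cases n) auto
  then show ?case using step by simp
qed simp

lemma coprime_solution:
  fixes x y z :: nat
  assumes cop: "coprime x y" and pos: "x > 0" "y > 0" "z \<ge> 2"
    and eq: "(x + y) ^ z = (2 * x) ^ z + y ^ z"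
  shows "x = 2 \<and> z = 2"
proof -
  have eqi: "(int x + int y) ^ z - int y ^ z = (2 * int x) ^ z"
    using arg_cong[OF eq, of int] by simp
  have zpow: "w ^ z = w * w ^ (z - 1)" for w :: int
    using pos by (cases z) auto
  have two: "p = 2" if p: "prime p" "p dvd x" for p
  proof (rule ccontr)
    assume "p \<noteq> 2"
    with p have odd: "odd p" by (metis primes_dvd_imp_eq two_is_prime_nat)
    have py: "\<not> p dvd y" using cop p by (meson coprime_common_divisor not_prime_unit)
    \<comment> \<open>One factor \<open>x\<close> is reserved for \<open>a - b\<close>, where
      \<open>a = x + y\<close> and \<open>b = y\<close>; each of the other \<open>z - 1\<close>
      supplies a \<open>p\<close>.\<close>
    have "int p ^ (z - 1) dvd int x ^ (z - 1)" using p by (simp add: dvd_power_same)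
    then have "int x * int p ^ (z - 1) dvd 2 ^ z * int x ^ z"
      unfolding zpow[of "int x"] by (intro dvd_mult mult_dvd_mono) auto
    then have "p ^ (z - 1) dvd z"
      using prime_power_dvd_exponent[OF p(1) odd, of "int x + int y" "int y" "z - 1" z] p py pos eqi
      by (simp add: power_mult_distrib)
    then have "p ^ (z - 1) \<le> z" using pos by (simp add: dvd_imp_le)
    moreover have "p \<ge> 3" using \<open>p \<noteq> 2\<close> prime_ge_2_nat[OF p(1)] by simp
    then have "3 ^ (z - 1) \<le> p ^ (z - 1)" by (rule power_mono) simp
    ultimately show False using less_three_power_pred pos by (metis le_trans not_le)
  qed
  have "even x"
  proof (rule ccontr)
    assume "odd x"
    then have "x = 1" using two prime_factor_nat by blast
    then have "even ((1 + y) ^ z) = even (y ^ z)" using eq pos by simp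
    then show False using pos by simp
  qed
  then have "odd y" using cop by (metis coprime_common_divisor odd_one)
  have "even z"
  proof (rule ccontr)
    assume "odd z"
    \<comment> \<open>For odd \<open>z\<close> the cofactor of \<open>x\<close> in
      \<open>(x + y) ^ z - y ^ z\<close> is odd, which this divisibility contradicts.\<close>
    have "int x * 2 dvd (2 * int x) ^ z"
      unfolding zpow[of "2 * int x"] by simp
    then show False
      using not_prime_mult_diff_dvd_power_diff[of 2 "int x + int y" "int y" z]
        \<open>odd z\<close> \<open>odd y\<close> \<open>even x\<close> pos eqi by simp
  qed
  then obtain m where m: "z = 2 * m" by blast
  have "m > 0" using m pos by simp
  \<comment> \<open>The equation becomes a difference of squares with factors \<open>D\<close> and
    \<open>D + 2 * y ^ m\<close>, the latter being \<open>(x + y) ^ m + y ^ m\<close>.\<close>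
  define D where "D = (x + y) ^ m - y ^ m"
  have D: "(x + y) ^ m = D + y ^ m"
    unfolding D_def by (simp add: power_mono)
  have "(D + y ^ m) ^ 2 = (2 * x) ^ z + (y ^ m) ^ 2"
    using eq unfolding D[symmetric] m by (simp add: power_mult mult.commute[of 2 m])
  then have prod: "D * (D + 2 * y ^ m) = (2 * x) ^ z"
    by (simp add: power2_eq_square algebra_simps)
  have w: "p = 2" if "prime p" "p dvd 2 * x" for p
    using that two by (metis prime_dvd_mult_iff primes_dvd_imp_eq two_is_prime_nat)
  have eq_two: "n = 2" if "n dvd (2 * x) ^ z" "even n" "\<not> 4 dvd n" for n
    using eq_two_if_not_four_dvd[of "2 * x" n z] w that by blast
  have "int x dvd int D"
    using power_diff_sumr2[of "int x + int y" m "int y"] arg_cong[OF D, of int] by simp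
  then have xD: "x dvd D" by simp
  then have "even D" using \<open>even x\<close> dvd_trans by blast
  have "y ^ m > 0" using pos by simp
  \<comment> \<open>The factors differ by twice an odd number. If \<open>4\<close> divided
    \<open>D\<close>, the larger factor would be \<open>2\<close>, which leaves no room for a
    positive \<open>D\<close>.\<close>
  have "\<not> 4 dvd D"
  proof
    assume "4 dvd D"
    moreover have "\<not> 4 dvd 2 * y ^ m"
      using \<open>odd y\<close> by (metis even_power mult_dvd_mono nat_mult_dvd_cancel_disj numeral_Bit0
        mult_2 zero_neq_numeral)
    ultimately have "\<not> 4 dvd D + 2 * y ^ m" by (simp add: dvd_add_right_iff)
    moreover have "D + 2 * y ^ m dvd (2 * x) ^ z" unfolding prod[symmetric] by simp
    ultimately have "D + 2 * y ^ m = 2"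
      using eq_two \<open>even D\<close> by simp
    then have "D = 0" using \<open>y ^ m > 0\<close> by linarith
    then show False using prod pos by simp
  qed
  moreover have "D dvd (2 * x) ^ z" unfolding prod[symmetric] by simp
  ultimately have D2: "D = 2"
    using eq_two \<open>even D\<close> by simp
  then have "x = 2"
    using xD \<open>even x\<close> pos by (simp add: dvd_antisym)
  have "m = 1"
  proof (rule ccontr)
    assume "m \<noteq> 1"
    then obtain k where k: "m = Suc k" "k > 0" using \<open>m > 0\<close> by (cases m) auto
    \<comment> \<open>Split \<open>(2 + y) ^ m\<close> as
      \<open>2 * (2 + y) ^ k + y * (2 + y) ^ k\<close>: the first summand exceeds \<open>2\<close>
      and the second is at least \<open>y ^ m\<close>, against \<open>D = 2\<close>.\<close>
    have "y ^ k \<le> (2 + y) ^ k" by (simp add: power_mono)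
    then have "y * y ^ k \<le> y * (2 + y) ^ k" by simp
    moreover have "1 < (2 + y) ^ k" using k by (intro one_less_power) auto
    ultimately have "y ^ m + 2 < (2 + y) ^ m"
      unfolding k power_Suc distrib_right by linarith
    then show False using D D2 \<open>x = 2\<close> by simp
  qed
  then show ?thesis using \<open>x = 2\<close> m by simp
qed

theorem mainTheorem9:
  shows "{(x, y, z) :: nat \<times> nat \<times> nat | x y z.
            x > 0 \<and> y > 0 \<and> z > 0 \<and> (x + y) ^ z = (2 * x) ^ z + y ^ z}
         = {(2 * t, 3 * t, 2) | t. t > 0}"
proof -
  have sol: "\<exists>t>0. x = 2 * t \<and> y = 3 * t \<and> z = 2"
    if pos: "x > 0" "y > 0" "z > 0" and eq: "(x + y) ^ z = (2 * x) ^ z + y ^ z" for x y z :: nat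
  proof -
    define g where "g = gcd x y"
    have g: "g > 0" using pos by (simp add: g_def)
    obtain x' y' where xy: "x = x' * g" "y = y' * g" and cop: "coprime x' y'"
      using gcd_coprime_exists[of x y] g unfolding g_def by auto
    have "g ^ z * (x' + y') ^ z = g ^ z * ((2 * x') ^ z + y' ^ z)"
    proof -
      have "g ^ z * (x' + y') ^ z = (x + y) ^ z"
        unfolding xy by (simp add: mult.commute distrib_left flip: power_mult_distrib)
      then show ?thesis
        using eq unfolding xy by (simp add: power_mult_distrib distrib_left mult_ac)
    qed
    then have eq': "(x' + y') ^ z = (2 * x') ^ z + y' ^ z" using g by simp
    have "x' > 0" "y' > 0" using pos xy by auto
    \<comment> \<open>For \<open>z = 1\<close> the equation would force
      \<open>x = 0\<close>.\<close>
    have "z \<noteq> 1" using eq pos by auto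
    then have "x' = 2 \<and> z = 2"
      using coprime_solution[OF cop \<open>x' > 0\<close> \<open>y' > 0\<close> _ eq'] pos by simp
    \<comment> \<open>The equation \<open>(2 + y') ^ 2 = 16 + y' ^ 2\<close> is linear in
      \<open>y'\<close>.\<close>
    moreover from this have "y' = 3" using eq' by (simp add: power2_eq_square)
    ultimately show ?thesis using g xy by (intro exI[of _ g]) simp
  qed
  show ?thesis (is "?S = ?T")
  proof
    show "?S \<subseteq> ?T" using sol by blast
    \<comment> \<open>This is the Pythagorean triple 3, 4, 5 scaled by \<open>t\<close>.\<close>
    show "?T \<subseteq> ?S" by (auto simp: power2_eq_square)
  qed
qed

end
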